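(* The following are equivalent for a finite digraph $G$: (i) $G$ has no in-out cycles. (ii) $G$ has a path-complete decomposition into bicycles. (iii) The set $\operatorname{Path}(G)$ of all paths in $G$ is well quasi-ordered under the subpath ordering.
   Context: A digraph is a set $G$ of vertices with a binary relation $E(G)\subseteq G\times G$ (loops allowed); $u\to v$ means $(u,v)\in E(G)$. A path is a sequence $v_1\to v_2\to\dots\to v_k$ ($k\ge1$) of vertices with $v_i\to v_{i+1}$ for all $i$ (vertices may repeat; paths of length $0$, i.e. $k=1$, are allowed). It is simple if all its vertices are distinct; it is a cycle if $k\ge2$ and $v_1=v_k$, and a simple cycle if moreover $v_1,\dots,v_{k-1}$ are distinct. A subpath of $v_1\to\dots\to v_k$ is a path $v_i\to\dots\to v_j$ with $1\le i\le j\le k$; this defines the subpath ordering on the set $\operatorname{Path}(G)$ of all paths in $G$. An in-out cycle in $G$ is a cycle that contains a vertex of in-degree $>1$ and a vertex of out-degree $>1$ (degrees taken in $G$). A finite collection of subgraphs $H_1,\dots,H_n$ of $G$ is a path-complete decomposition of $G$ if $\operatorname{Path}(G)=\bigcup_{i=1}^n\operatorname{Path}(H_i)$; it is a decomposition into bicycles if each $H_i$ is a bicycle. A bicycle is a digraph consisting precisely of two vertex-disjoint simple cycles $\pi_1$ (initial cycle) and $\pi_2$ (terminal cycle), connected by a simple directed path $\tau$ (connecting path) from a vertex of $\pi_1$ to a vertex of $\pi_2$, no internal vertex of which belongs to $\pi_1$ or $\pi_2$. Either or both of $\pi_1,\pi_2$ are allowed to be absent (so a simple path, or a simple cycle with a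 simple path leading into it or out of it and otherwise disjoint from it, are bicycles), and a single simple cycle is also a bicycle; but if both cycles are present they share no vertex, so $\tau$ is non-trivial. A poset is well quasi-ordered if it has no infinite strictly decreasing sequences and no infinite antichains. *)

theory Defs
  imports "Graph_Theory.Graph_Theory" "HOL-Library.Sublist"
begin

text \<open>
  Digraphs without parallel arcs (loops allowed) are those of \<^locale>\<open>pair_wf_digraph\<close>;
  a path is a \<^const>\<open>vwalk\<close>, i.e. the nonempty list of its vertices, and a simple path is
  a \<^const>\<open>vpath\<close>.
\<close>

definition paths :: "'a pair_pre_digraph \<Rightarrow> 'a vwalk set" where
  "paths G = {p. vwalk p (with_proj G)}"

definition is_cycle :: "'a pair_pre_digraph \<Rightarrow> 'a vwalk \<Rightarrow> bool" where
  "is_cycle G c \<longleftrightarrow> c \<in> paths G \<and> 2 \<le> length c \<and> hd c = last c"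

definition simple_cycle :: "'a pair_pre_digraph \<Rightarrow> 'a vwalk \<Rightarrow> bool" where
  "simple_cycle G c \<longleftrightarrow> is_cycle G c \<and> distinct (butlast c)"

definition in_out_cycle :: "'a pair_pre_digraph \<Rightarrow> 'a vwalk \<Rightarrow> bool" where
  "in_out_cycle G c \<longleftrightarrow> is_cycle G c \<and>
     (\<exists>u \<in> set c. in_degree (with_proj G) u > 1) \<and>
     (\<exists>v \<in> set c. out_degree (with_proj G) v > 1)"

text \<open>
  The initial cycle \<open>c\<^sub>1\<close>, the connecting path \<open>t\<close> and the terminal cycle \<open>c\<^sub>2\<close> of a bicycle;
  an absent cycle is encoded by \<open>[]\<close>.  A present cycle meets \<open>t\<close> only in the corresponding
  endpoint of \<open>t\<close>.  If both cycles are present, their disjointness forces \<open>t\<close> to be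
  non-trivial; a single simple cycle is the case where the other cycle is absent and \<open>t\<close>
  consists of one vertex of the cycle.
\<close>

definition bicycle :: "'a pair_pre_digraph \<Rightarrow> bool" where
  "bicycle H \<longleftrightarrow> (\<exists>c\<^sub>1 t c\<^sub>2.
     (c\<^sub>1 = [] \<or> simple_cycle H c\<^sub>1 \<and> set t \<inter> set c\<^sub>1 = {hd t}) \<and>
     (c\<^sub>2 = [] \<or> simple_cycle H c\<^sub>2 \<and> set t \<inter> set c\<^sub>2 = {last t}) \<and>
     set c\<^sub>1 \<inter> set c\<^sub>2 = {} \<and>
     vpath t (with_proj H) \<and>
     pverts H = set c\<^sub>1 \<union> set t \<union> set c\<^sub>2 \<and>
     parcs H = set (vwalk_arcs c\<^sub>1) \<union> set (vwalk_arcs t) \<union> set (vwalk_arcs c\<^sub>2))"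

definition path_complete_decomposition ::
  "'a pair_pre_digraph \<Rightarrow> 'a pair_pre_digraph set \<Rightarrow> bool" where
  "path_complete_decomposition G Hs \<longleftrightarrow>
     finite Hs \<and> (\<forall>H \<in> Hs. subgraph (with_proj H) (with_proj G)) \<and>
     paths G = (\<Union>H \<in> Hs. paths H)"

text \<open>
  Intended for a partial order \<open>le\<close> on \<open>A\<close>.
\<close>

definition well_quasi_ordered_on :: "'b set \<Rightarrow> ('b \<Rightarrow> 'b \<Rightarrow> bool) \<Rightarrow> bool" where
  "well_quasi_ordered_on A le \<longleftrightarrow>
     \<not> (\<exists>f :: nat \<Rightarrow> 'b. \<forall>i. f i \<in> A \<and> le (f (Suc i)) (f i) \<and> f (Suc i) \<noteq> f i) \<and>
     \<not> (\<exists>S \<subseteq> A. infinite S \<and> (\<forall>x \<in> S. \<forall>y \<in> S. x \<noteq> y \<longrightarrow> \<not> le x y))"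

text \<open>
  Since paths are nonempty lists of vertices, the subpath ordering on \<^term>\<open>paths G\<close> is the
  restriction of the contiguous-sublist order \<^const>\<open>sublist\<close>.
\<close>

end

theory Submission
  imports Defs
begin

text \<open>
  The theorem is proved as a cycle of implications (i), (ii), (iii), (i).

  Without in-out cycles, every simple cycle is a \<^emph>\<open>source cycle\<close> (all its vertices have in-degree
  at most 1, so a walk that ends on it has never been anywhere else) or a \<^emph>\<open>sink cycle\<close> (all its
  vertices have out-degree at most 1, so a walk that reaches it never leaves).  Hence a path
  starts with its vertices on source cycles (if any) and ends with those on sink cycles (if any); a
  vertex that it visits twice lies on a cycle, so the part in between is simple.  All source
  vertices of the path lie on one source cycle, all sink vertices on one sink cycle, and these two
  cycles together with the middle part form a bicycle that carries the path (\<open>path_in_bicycle\<close>).  A finite digraph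
  has finitely many bicycle subgraphs, and they constitute the decomposition.

  In a bicycle, a path first runs on the initial cycle, where each vertex has a unique predecessor,
  and then in the rest, where each vertex has a unique successor
  (\<open>bicycle_path_two_sided_deterministic\<close>).  Up to finitely many choices of the two functional
  relations and of the two vertices next to the seam, such a path is therefore determined by the
  lengths of its two halves, and enlarging both lengths extends the path at its two ends.  So the
  well-quasi-orderedness of pairs of natural numbers carries over to the paths
  (\<open>well_quasi_ordered_on_two_sided_deterministic\<close>).

  Finally, an in-out cycle contains a simple one, since otherwise its base vertex would lie on a
  source or sink cycle, which would trap it entirely (\<open>in_out_cycle_simple\<close>).  Enter that simple
  cycle through an arc that does not belong to it, run around it any number of times, and
  leave it through an arc that does not belong to it.  The first and the last arc of such a path
  mark its ends, so no such path is a proper subpath of another: they form an infinite antichain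
  (\<open>in_out_cycle_imp_not_wqo\<close>).
\<close>

section \<open>Arcs of walks\<close>

lemma set_vwalk_arcs_append_Cons:
  "set (vwalk_arcs (xs @ x # ys)) = set (vwalk_arcs (xs @ [x])) \<union> set (vwalk_arcs (x # ys))"
  by (induct xs rule: vwalk_arcs.induct) auto

lemma Domain_vwalk_arcs: "Domain (set (vwalk_arcs p)) = set (butlast p)"
  by (induct p rule: vwalk_arcs.induct) auto

lemma Range_vwalk_arcs: "Range (set (vwalk_arcs p)) = set (tl p)"
  by (induct p rule: vwalk_arcs.induct) auto

lemma set_vwalk_arcs_rev_converse:
  "set (vwalk_arcs (rev p)) = (set (vwalk_arcs p))\<inverse>"
  by (auto simp: set_vwalk_arcs_rev)

lemma set_vwalk_arcs_sublist:
  assumes "sublist q p"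
  shows "set (vwalk_arcs q) \<subseteq> set (vwalk_arcs p)"
  using assms by (auto simp: sublist_def intro: in_set_vwalk_arcs_append1)

lemma single_valued_vwalk_arcs:
  assumes "distinct (butlast p)"
  shows "single_valued (set (vwalk_arcs p))"
  using assms
proof (induct p rule: vwalk_arcs.induct)
  case (3 x y xs)
  have "x \<notin> Domain (set (vwalk_arcs (y # xs)))"
    using 3 by (simp add: Domain_vwalk_arcs)
  moreover have "single_valued (set (vwalk_arcs (y # xs)))"
    using 3 by simp
  ultimately show ?case
    by (auto simp: single_valued_def)
qed auto

lemma single_valued_converse_vwalk_arcs:
  assumes "distinct (tl p)"
  shows "single_valued ((set (vwalk_arcs p))\<inverse>)"
  using single_valued_vwalk_arcs[of "rev p"] assms
  by (simp add: set_vwalk_arcs_rev_converse butlast_rev)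

lemma set_confined_forward:
  assumes "\<And>x y. x \<in> C \<Longrightarrow> (x, y) \<in> set (vwalk_arcs w) \<Longrightarrow> y \<in> C"
    and "w = [] \<or> hd w \<in> C"
  shows "set w \<subseteq> C"
  using assms
proof (induct w rule: vwalk_arcs.induct)
  case (3 x y xs)
  have "x \<in> C"
    using 3(3) by simp
  then have "y \<in> C"
    by (rule 3(2)) simp
  then have "set (y # xs) \<subseteq> C"
    by (intro 3(1)) (auto intro: 3(2))
  with \<open>x \<in> C\<close> show ?case by simp
qed auto

text \<open>Reversing the walk turns the forward version into the backward one.\<close>

lemma set_confined_backward:
  assumes arcs: "\<And>x y. y \<in> C \<Longrightarrow> (x, y) \<in> set (vwalk_arcs w) \<Longrightarrow> x \<in> C"
    and last: "w = [] \<or> last w \<in> C"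
  shows "set w \<subseteq> C"
proof -
  have "set (rev w) \<subseteq> C"
  proof (rule set_confined_forward)
    show "y \<in> C" if "x \<in> C" "(x, y) \<in> set (vwalk_arcs (rev w))" for x y
      using that(2) by (intro arcs[OF that(1)]) (simp add: set_vwalk_arcs_rev_converse)
    show "rev w = [] \<or> hd (rev w) \<in> C"
      using last by (simp add: hd_rev)
  qed
  then show ?thesis by simp
qed

lemma mem_paths_iff:
  "p \<in> paths G \<longleftrightarrow> p \<noteq> [] \<and> set p \<subseteq> pverts G \<and> set (vwalk_arcs p) \<subseteq> parcs G"
  by (auto simp: paths_def vwalk_def)

lemma sublist_mem_paths:
  assumes "p \<in> paths G" "sublist q p" "q \<noteq> []"
  shows "q \<in> paths G"
  using assms set_vwalk_arcs_sublist[OF assms(2)] set_mono_sublist[OF assms(2)]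
  by (auto simp: mem_paths_iff)


section \<open>Cycles\<close>

text \<open>
  The vertex list of a cycle mentions its base vertex at both ends, so that dropping either
  occurrence loses no vertex: every vertex of a cycle has a successor and a predecessor on it.
\<close>

lemma cycle_set:
  assumes "is_cycle G c"
  shows "set (butlast c) = set c" "set (tl c) = set c"
proof -
  obtain x w where c: "c = x # w" "w \<noteq> []" "last w = x"
    using assms by (cases c) (auto simp: is_cycle_def split: if_splits)
  have "w = butlast w @ [x]"
    using c by (metis append_butlast_last_id)
  then have "set w = insert x (set (butlast w))"
    by (metis list.set(2) list.simps(15) rotate1.simps(2) set_rotate1)
  with c show "set (butlast c) = set c" "set (tl c) = set c" by auto
qed

lemma simple_cycle_distinct_tl:
  assumes "simple_cycle G c"
  shows "distinct (tl c)"
proof -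
  obtain x w where c: "c = x # w" "w \<noteq> []" "last w = x"
    using assms by (cases c) (auto simp: simple_cycle_def is_cycle_def split: if_splits)
  have "w = butlast w @ [x]"
    using c by (metis append_butlast_last_id)
  moreover have "distinct (butlast c)"
    using assms by (simp add: simple_cycle_def)
  then have "distinct (butlast w @ [x])"
    using c by auto
  ultimately show ?thesis using c by auto
qed

lemma simple_cycle_single_valued:
  assumes "simple_cycle G c"
  shows "single_valued (set (vwalk_arcs c))" "single_valued ((set (vwalk_arcs c))\<inverse>)"
  using assms simple_cycle_distinct_tl[OF assms]
  by (auto simp: simple_cycle_def single_valued_vwalk_arcs single_valued_converse_vwalk_arcs)

text \<open>
  Short-cutting the walk from the second vertex of a cycle back to its base to a simple path
  gives a simple cycle with the same base.  Keeping the base matters: it is used below to compare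
  the two cycles.
\<close>

lemma cycle_contains_simple_cycle:
  assumes "is_cycle G c"
  obtains c' where "simple_cycle G c'" "hd c' = hd c" "set c' \<subseteq> set c"
proof -
  obtain x w where c: "c = x # w" "w \<noteq> []" "last w = x"
    using assms by (cases c) (auto simp: is_cycle_def split: if_splits)
  define w' where "w' = vwalk_to_vpath w"
  have "vwalk w (with_proj G)" and arc: "(x, hd w) \<in> parcs G"
    using assms c by (auto simp: is_cycle_def mem_paths_iff vwalk_def)
  then have w': "vpath w' (with_proj G)" "hd w' = hd w" "last w' = x" "w' \<noteq> []" "set w' \<subseteq> set w"
    using c vwalk_to_vpath_vpath vwalk_to_vpath_nonempty[of w] vwalk_to_vpath_subset[of _ w]
    by (auto simp: w'_def vwalk_to_vpath_hd vwalk_to_vpath_last)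
  have "x # w' \<in> paths G"
    using w' arc assms c by (auto simp: mem_paths_iff vpath_def vwalk_def is_cycle_def)
  moreover have "distinct (butlast w' @ [x])"
    using w' by (metis append_butlast_last_id vpathE)
  ultimately have "simple_cycle G (x # w')"
    using w'(3,4) by (cases w') (auto simp: simple_cycle_def is_cycle_def)
  then show thesis using that[of "x # w'"] w' c by auto
qed


section \<open>Source cycles and sink cycles\<close>

definition source_cycle :: "'a pair_pre_digraph \<Rightarrow> 'a vwalk \<Rightarrow> bool" where
  "source_cycle G c \<longleftrightarrow> simple_cycle G c \<and> (\<forall>x \<in> set c. in_degree (with_proj G) x \<le> 1)"

definition sink_cycle :: "'a pair_pre_digraph \<Rightarrow> 'a vwalk \<Rightarrow> bool" where
  "sink_cycle G c \<longleftrightarrow> simple_cycle G c \<and> (\<forall>x \<in> set c. out_degree (with_proj G) x \<le> 1)"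

lemma in_degree_gt_1_iff:
  assumes "finite (parcs G)"
  shows "in_degree (with_proj G) y > 1 \<longleftrightarrow>
    (\<exists>x x'. (x, y) \<in> parcs G \<and> (x', y) \<in> parcs G \<and> x \<noteq> x')"
proof -
  have "finite (in_arcs (with_proj G) y)"
    by (rule finite_subset[OF _ assms]) (auto simp: in_arcs_def)
  then have "\<not> in_degree (with_proj G) y > 1 \<longleftrightarrow>
      (\<forall>a \<in> in_arcs (with_proj G) y. \<forall>b \<in> in_arcs (with_proj G) y. a = b)"
    unfolding in_degree_def by (simp add: card_le_Suc0_iff_eq not_less)
  then show ?thesis by (fastforce simp: in_arcs_def)
qed

lemma out_degree_gt_1_iff:
  assumes "finite (parcs G)"
  shows "out_degree (with_proj G) x > 1 \<longleftrightarrow>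
    (\<exists>y y'. (x, y) \<in> parcs G \<and> (x, y') \<in> parcs G \<and> y \<noteq> y')"
proof -
  have "finite (out_arcs (with_proj G) x)"
    by (rule finite_subset[OF _ assms]) (auto simp: out_arcs_def)
  then have "\<not> out_degree (with_proj G) x > 1 \<longleftrightarrow>
      (\<forall>a \<in> out_arcs (with_proj G) x. \<forall>b \<in> out_arcs (with_proj G) x. a = b)"
    unfolding out_degree_def by (simp add: card_le_Suc0_iff_eq not_less)
  then show ?thesis by (fastforce simp: out_arcs_def)
qed

text \<open>
  A vertex of a sink cycle has an outgoing arc on the cycle, and this is its only outgoing arc.
\<close>

lemma sink_cycle_traps_walk:
  assumes "finite (parcs G)" "sink_cycle G c"
    and w: "set (vwalk_arcs w) \<subseteq> parcs G" "w = [] \<or> hd w \<in> set c"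
  shows "set w \<subseteq> set c" "set (vwalk_arcs w) \<subseteq> set (vwalk_arcs c)"
proof -
  have c: "is_cycle G c" "set (vwalk_arcs c) \<subseteq> parcs G"
    using assms(2) by (auto simp: sink_cycle_def simple_cycle_def is_cycle_def mem_paths_iff)
  have arc: "(x, y) \<in> set (vwalk_arcs c)" if "x \<in> set c" "(x, y) \<in> parcs G" for x y
  proof -
    have "x \<in> Domain (set (vwalk_arcs c))"
      using that(1) cycle_set(1)[OF c(1)] by (simp add: Domain_vwalk_arcs)
    then obtain y' where y': "(x, y') \<in> set (vwalk_arcs c)"
      by blast
    then have "(x, y') \<in> parcs G"
      using c(2) by blast
    moreover have "\<not> out_degree (with_proj G) x > 1"
      using that(1) assms(2) by (simp add: sink_cycle_def not_less)
    ultimately have "y = y'"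
      using that(2) unfolding out_degree_gt_1_iff[OF assms(1)] by blast
    with y' show ?thesis by simp
  qed
  show "set w \<subseteq> set c"
  proof (rule set_confined_forward[OF _ w(2)])
    fix x y assume "x \<in> set c" "(x, y) \<in> set (vwalk_arcs w)"
    then have "(x, y) \<in> set (vwalk_arcs c)"
      using arc w(1) by blast
    then show "y \<in> set c"
      by (auto dest: arcs_in_vwalk_arcs)
  qed
  then show "set (vwalk_arcs w) \<subseteq> set (vwalk_arcs c)"
    using w(1) arc by (fastforce dest: arcs_in_vwalk_arcs)
qed

text \<open>
  Dually, the only arc into a vertex of a source cycle is the arc of the cycle, so a walk that ends
  on the cycle can be traced back along it.
\<close>

lemma source_cycle_traps_walk:
  assumes "finite (parcs G)" "source_cycle G c"
    and w: "set (vwalk_arcs w) \<subseteq> parcs G" "w = [] \<or> last w \<in> set c"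
  shows "set w \<subseteq> set c" "set (vwalk_arcs w) \<subseteq> set (vwalk_arcs c)"
proof -
  have c: "is_cycle G c" "set (vwalk_arcs c) \<subseteq> parcs G"
    using assms(2) by (auto simp: source_cycle_def simple_cycle_def is_cycle_def mem_paths_iff)
  have arc: "(x, y) \<in> set (vwalk_arcs c)" if "y \<in> set c" "(x, y) \<in> parcs G" for x y
  proof -
    have "y \<in> Range (set (vwalk_arcs c))"
      using that(1) cycle_set(2)[OF c(1)] by (simp add: Range_vwalk_arcs)
    then obtain x' where x': "(x', y) \<in> set (vwalk_arcs c)"
      by blast
    then have "(x', y) \<in> parcs G"
      using c(2) by blast
    moreover have "\<not> in_degree (with_proj G) y > 1"
      using that(1) assms(2) by (simp add: source_cycle_def not_less)
    ultimately have "x = x'"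
      using that(2) unfolding in_degree_gt_1_iff[OF assms(1)] by blast
    with x' show ?thesis by simp
  qed
  show "set w \<subseteq> set c"
  proof (rule set_confined_backward[OF _ w(2)])
    fix x y assume "y \<in> set c" "(x, y) \<in> set (vwalk_arcs w)"
    then have "(x, y) \<in> set (vwalk_arcs c)"
      using arc w(1) by blast
    then show "x \<in> set c"
      by (auto dest: arcs_in_vwalk_arcs)
  qed
  then show "set (vwalk_arcs w) \<subseteq> set (vwalk_arcs c)"
    using w(1) arc by (fastforce dest: arcs_in_vwalk_arcs)
qed

lemma repeated_vertex_on_simple_cycle:
  assumes "p \<in> paths G" "\<not> distinct p"
  obtains c v where "simple_cycle G c" "v \<in> set c" "v \<in> set p"
proof -
  obtain xs ys zs v where p: "p = xs @ [v] @ ys @ [v] @ zs"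
    using not_distinct_decomp[OF assms(2)] by blast
  have "sublist (v # ys @ [v]) p"
    unfolding p sublist_def by (intro exI[of _ xs] exI[of _ zs]) simp
  then have "is_cycle G (v # ys @ [v])"
    using sublist_mem_paths[OF assms(1)] by (simp add: is_cycle_def)
  then obtain c where c: "simple_cycle G c" "hd c = v"
    by (rule cycle_contains_simple_cycle) auto
  then have "v \<in> set c"
    by (cases c) (auto simp: simple_cycle_def is_cycle_def)
  with c p that show thesis by auto
qed


section \<open>Without in-out cycles, every path lies in a bicycle\<close>

text \<open>
  The path is cut as \<open>q @ m @ s\<close>, where \<open>q\<close> is the part on source cycles, \<open>s\<close> the remaining part
  on sink cycles, and \<open>m\<close> what lies between them.  The connecting path of the bicycle is \<open>m\<close>
  together with the last vertex of \<open>q\<close> and the first vertex of \<open>s\<close>.  An isolated cycle is both a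
  source and a sink cycle; giving priority to source cycles makes the parts disjoint.
\<close>

lemma path_in_bicycle:
  assumes G: "pair_fin_digraph G" and no: "\<nexists>c. in_out_cycle G c" and p: "p \<in> paths G"
  obtains H where "bicycle H" "subgraph (with_proj H) (with_proj G)" "p \<in> paths H"
proof -
  interpret pair_fin_digraph G by fact
  note fin = pair_finite_arcs
  \<comment> \<open>Vertices on source cycles are closed under predecessors, those on sink cycles under successors.\<close>
  define So where "So = {x. \<exists>c. source_cycle G c \<and> x \<in> set c}"
  define Si where "Si = {x. \<exists>c. sink_cycle G c \<and> x \<in> set c}"
  have So_back: "set w \<subseteq> So" if "set (vwalk_arcs w) \<subseteq> parcs G" "w \<noteq> []" "last w \<in> So" for w
    using that source_cycle_traps_walk(1)[OF fin] unfolding So_def by blast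
  have Si_fwd: "set w \<subseteq> Si" if "set (vwalk_arcs w) \<subseteq> parcs G" "w \<noteq> []" "hd w \<in> Si" for w
    using that sink_cycle_traps_walk(1)[OF fin] unfolding Si_def by blast
  have repeat: "\<exists>v \<in> set w. v \<in> So \<union> Si" if w: "w \<in> paths G" "\<not> distinct w" for w
  proof -
    obtain c v where c: "simple_cycle G c" "v \<in> set c" "v \<in> set w"
      using repeated_vertex_on_simple_cycle[OF w] .
    have "source_cycle G c \<or> sink_cycle G c"
      using c(1) no unfolding in_out_cycle_def source_cycle_def sink_cycle_def simple_cycle_def
      by (meson not_less)
    with c show ?thesis by (auto simp: So_def Si_def)
  qed

  define q r where "q = takeWhile (\<lambda>x. x \<in> So) p" and "r = dropWhile (\<lambda>x. x \<in> So) p"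
  define m s where "m = takeWhile (\<lambda>x. x \<notin> Si) r" and "s = dropWhile (\<lambda>x. x \<notin> Si) r"
  have p_split: "p = q @ m @ s" "r = m @ s"
    by (simp_all add: q_def r_def m_def s_def)
  have arcs_sub: "set (vwalk_arcs w) \<subseteq> parcs G" if "sublist w p" for w
    using p set_vwalk_arcs_sublist[OF that] by (auto simp: mem_paths_iff)
  have q_So: "set q \<subseteq> So"
    by (auto simp: q_def dest: set_takeWhileD)
  have r_So: "set r \<inter> So = {}"
  proof (rule ccontr)
    assume "set r \<inter> So \<noteq> {}"
    then obtain a x b where r: "r = a @ x # b" and x: "x \<in> So"
      by (metis disjoint_iff in_set_conv_decomp)
    have "sublist (a @ [x]) p"
      unfolding p_split(1) p_split(2)[symmetric] r sublist_def by (intro exI[of _ q] exI[of _ b]) simp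
    then have "set (a @ [x]) \<subseteq> So"
      using x by (intro So_back arcs_sub) auto
    then have "hd r \<in> So"
      unfolding r by (cases a) auto
    moreover have "hd r \<notin> So"
      using hd_dropWhile[of "\<lambda>x. x \<in> So" p] r unfolding r_def by (metis append_is_Nil_conv list.distinct(1))
    ultimately show False by simp
  qed
  have m_Si: "set m \<inter> Si = {}"
    by (auto simp: m_def dest: set_takeWhileD)
  have s_hd: "hd s \<in> Si" if "s \<noteq> []"
    using that hd_dropWhile[of "\<lambda>x. x \<notin> Si" r] by (auto simp: s_def)
  have m_distinct: "distinct m"
  proof (rule ccontr)
    assume nd: "\<not> distinct m"
    then have "m \<in> paths G"
      using p by (intro sublist_mem_paths[OF p]) (auto simp: p_split(1))
    from repeat[OF this nd] show False
      using r_So m_Si p_split(2) by auto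
  qed

  obtain c1 where c1: "if q = [] then c1 = [] else source_cycle G c1 \<and> last q \<in> set c1"
  proof (cases "q = []")
    case False
    then have "last q \<in> So"
      using q_So last_in_set[of q] by blast
    with that False show thesis by (auto simp: So_def)
  qed auto
  obtain c2 where c2: "if s = [] then c2 = [] else sink_cycle G c2 \<and> hd s \<in> set c2"
  proof (cases "s = []")
    case False
    with that s_hd show thesis by (auto simp: Si_def)
  qed auto
  have c1_So: "set c1 \<subseteq> So"
    using c1 by (auto simp: So_def split: if_splits)
  \<comment> \<open>A source vertex on \<open>c2\<close> would make all of \<open>c2\<close>, and so the first vertex of \<open>s\<close>, source
    vertices: go back from it to the base of \<open>c2\<close>, and from there around the whole cycle.\<close>
  have c2_So: "set c2 \<inter> So = {}"
  proof (rule ccontr)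
    assume "set c2 \<inter> So \<noteq> {}"
    then obtain x where x: "x \<in> set c2" "x \<in> So" by blast
    then have s: "s \<noteq> []" "sink_cycle G c2" "hd s \<in> set c2"
      using c2 by (auto split: if_splits)
    then have cyc: "is_cycle G c2" and arcs: "set (vwalk_arcs c2) \<subseteq> parcs G"
      by (auto simp: sink_cycle_def simple_cycle_def is_cycle_def mem_paths_iff)
    obtain a b where ab: "c2 = a @ x # b"
      using x(1) by (metis in_set_conv_decomp)
    have "set (a @ [x]) \<subseteq> So"
      using x(2) arcs set_vwalk_arcs_sublist[of "a @ [x]" c2] ab
      by (intro So_back) (auto simp: sublist_def)
    then have "last c2 \<in> So"
      using cyc ab by (cases a) (auto simp: is_cycle_def)
    then have "set c2 \<subseteq> So"
      using arcs x(1) by (intro So_back) auto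
    with s have "hd s \<in> So" by auto
    moreover have "hd s \<in> set r"
      using s by (simp add: p_split(2))
    ultimately show False using r_So by auto
  qed

  define t where "t = drop (length q - 1) q @ m @ take 1 s"
  have lastq: "drop (length q - 1) q = (if q = [] then [] else [last q])"
    by (induct q rule: rev_induct) auto
  have hds: "take 1 s = (if s = [] then [] else [hd s])"
    by (cases s) auto
  have t_eq: "t = (if q = [] then [] else [last q]) @ m @ (if s = [] then [] else [hd s])"
    by (simp only: t_def lastq hds)
  have p_t: "p = butlast q @ t @ tl s"
    by (cases s) (auto simp: p_split t_eq)
  have "t \<noteq> []"
    using p by (auto simp: t_eq p_split mem_paths_iff)
  have t_path: "t \<in> paths G"
    using \<open>t \<noteq> []\<close> by (intro sublist_mem_paths[OF p]) (auto simp: p_t)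
  have s_r: "hd s \<notin> So" if "s \<noteq> []"
    using r_So that by (cases s) (auto simp: p_split(2))
  have q_last: "last q \<in> So" if "q \<noteq> []"
    using q_So last_in_set[OF that] by blast
  have "distinct t"
    using q_last m_distinct m_Si s_hd r_So q_So s_r by (auto simp: t_eq p_split(2))
  have t_c1: "c1 = [] \<or> set t \<inter> set c1 = {hd t}"
    using c1 c1_So r_So s_r q_last by (auto simp: t_eq p_split(2) split: if_splits)
  have m_c2: "set m \<inter> set c2 = {}"
    using c2 m_Si by (auto simp: Si_def split: if_splits)
  have t_c2: "c2 = [] \<or> set t \<inter> set c2 = {last t}"
    using c2 c2_So m_c2 q_last by (auto simp: t_eq split: if_splits)
  have "set (vwalk_arcs q) \<subseteq> set (vwalk_arcs c1) \<and> set q \<subseteq> set c1"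
    using c1 source_cycle_traps_walk[OF fin, of c1 q] arcs_sub[of q]
    by (auto simp: p_split(1) split: if_splits)
  moreover have "set (vwalk_arcs s) \<subseteq> set (vwalk_arcs c2) \<and> set s \<subseteq> set c2"
    using c2 sink_cycle_traps_walk[OF fin, of c2 s] arcs_sub[of s]
    by (auto simp: p_split(1) sublist_append split: if_splits)
  moreover have "set (vwalk_arcs p) \<subseteq>
      set (vwalk_arcs q) \<union> set (vwalk_arcs t) \<union> set (vwalk_arcs s)"
  proof -
    have "set (vwalk_arcs p) \<subseteq> set (vwalk_arcs q) \<union> set (vwalk_arcs (t @ tl s))"
    proof (cases "q = []")
      case False
      then obtain q' x where "q = q' @ [x]" by (metis rev_exhaust)
      then show ?thesis
        using set_vwalk_arcs_append_Cons[of q' x "tl t @ tl s"] by (simp add: p_t t_eq)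
    qed (simp add: p_t)
    moreover have "set (vwalk_arcs (t @ tl s)) \<subseteq> set (vwalk_arcs t) \<union> set (vwalk_arcs s)"
    proof (cases s)
      case (Cons x s')
      then show ?thesis
        using set_vwalk_arcs_append_Cons[of "butlast t" x s'] by (simp add: t_eq butlast_append)
    qed simp
    ultimately show ?thesis by blast
  qed
  ultimately have p_arcs: "set (vwalk_arcs p) \<subseteq>
      set (vwalk_arcs c1) \<union> set (vwalk_arcs t) \<union> set (vwalk_arcs c2)"
    and p_verts: "set p \<subseteq> set c1 \<union> set t \<union> set c2"
    by (auto simp: p_split t_eq)

  define H where "H = \<lparr> pverts = set c1 \<union> set t \<union> set c2,
    parcs = set (vwalk_arcs c1) \<union> set (vwalk_arcs t) \<union> set (vwalk_arcs c2) \<rparr>"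
  have c1_simple: "c1 = [] \<or> simple_cycle G c1" and c2_simple: "c2 = [] \<or> simple_cycle G c2"
    using c1 c2 by (auto simp: source_cycle_def sink_cycle_def split: if_splits)
  have "c1 = [] \<or> simple_cycle H c1 \<and> set t \<inter> set c1 = {hd t}"
    "c2 = [] \<or> simple_cycle H c2 \<and> set t \<inter> set c2 = {last t}"
    using c1_simple c2_simple t_c1 t_c2
    by (auto simp: simple_cycle_def is_cycle_def mem_paths_iff H_def)
  moreover have "vpath t (with_proj H)"
    using \<open>t \<noteq> []\<close> \<open>distinct t\<close> by (auto simp: H_def vpath_def vwalk_def)
  moreover have "set c1 \<inter> set c2 = {}"
    using c1_So c2_So by blast
  moreover have "pverts H = set c1 \<union> set t \<union> set c2"
    "parcs H = set (vwalk_arcs c1) \<union> set (vwalk_arcs t) \<union> set (vwalk_arcs c2)"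
    by (simp_all add: H_def)
  ultimately have "bicycle H"
    unfolding bicycle_def by (intro exI[of _ c1] exI[of _ t] exI[of _ c2] conjI)
  moreover have "subgraph (with_proj H) (with_proj G)"
  proof -
    have "wf_digraph (with_proj H)"
      by unfold_locales (auto simp: H_def dest!: arcs_in_vwalk_arcs)
    then show ?thesis
      using c1_simple c2_simple t_path wf_digraph
      by (auto simp: subgraph_def compatible_def H_def simple_cycle_def is_cycle_def mem_paths_iff)
  qed
  moreover have "p \<in> paths H"
    using p p_arcs p_verts by (auto simp: mem_paths_iff H_def)
  ultimately show thesis by (rule that)
qed

lemma bicycle_decomposition:
  assumes G: "pair_fin_digraph G" and no: "\<nexists>c. in_out_cycle G c"
  shows "\<exists>Hs. path_complete_decomposition G Hs \<and> (\<forall>H \<in> Hs. bicycle H)"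
proof -
  interpret pair_fin_digraph G by fact
  define Hs where "Hs = {H. bicycle H \<and> subgraph (with_proj H) (with_proj G)}"
  have "Hs \<subseteq> (\<lambda>(V, E). \<lparr> pverts = V, parcs = E \<rparr>) ` (Pow (pverts G) \<times> Pow (parcs G))"
  proof
    fix H assume "H \<in> Hs"
    then have "(pverts H, parcs H) \<in> Pow (pverts G) \<times> Pow (parcs G)"
      by (auto simp: Hs_def subgraph_def)
    then show "H \<in> (\<lambda>(V, E). \<lparr> pverts = V, parcs = E \<rparr>) ` (Pow (pverts G) \<times> Pow (parcs G))"
      by (rule rev_image_eqI) simp
  qed
  then have "finite Hs"
    by (rule finite_subset) (simp add: pair_finite_verts pair_finite_arcs)
  moreover have "paths G = (\<Union>H \<in> Hs. paths H)"
  proof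
    show "paths G \<subseteq> (\<Union>H \<in> Hs. paths H)"
      using path_in_bicycle[OF G no] unfolding Hs_def by blast
    show "(\<Union>H \<in> Hs. paths H) \<subseteq> paths G"
      by (fastforce simp: Hs_def subgraph_def mem_paths_iff)
  qed
  ultimately have "path_complete_decomposition G Hs"
    by (auto simp: path_complete_decomposition_def Hs_def)
  then show ?thesis by (auto simp: Hs_def)
qed


section \<open>Paths determined by two lengths\<close>

text \<open>
  Dickson's lemma in dimension two.  Take \<open>x\<close> with \<open>f x\<close> minimal; unless \<open>x\<close> lies below another
  element, \<open>g\<close> is bounded by \<open>g x\<close>, hence constant on an infinite subset, where any two elements
  are comparable.
\<close>

lemma infinite_comparable_pair_nat2:
  fixes f g :: "'b \<Rightarrow> nat"
  assumes "infinite S"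
  obtains x y where "x \<in> S" "y \<in> S" "x \<noteq> y" "f x \<le> f y" "g x \<le> g y"
proof -
  obtain x where x: "x \<in> S" "\<And>y. y \<in> S \<Longrightarrow> f x \<le> f y"
    using ex_has_least_nat[of "\<lambda>x. x \<in> S" _ f] infinite_imp_nonempty[OF assms] by blast
  show thesis
  proof (cases "\<exists>y \<in> S. y \<noteq> x \<and> g x \<le> g y")
    case True
    with x that show thesis by blast
  next
    case False
    then have "g ` S \<subseteq> {..g x}"
      by (auto simp: not_le intro: less_imp_le)
    then have "finite (g ` S)"
      by (rule finite_subset) simp
    then obtain z where z: "infinite {y \<in> S. g y = g z}"
      using pigeonhole_infinite[OF assms] by blast
    then obtain a where a: "a \<in> {y \<in> S. g y = g z}"
      by (metis all_not_in_conv finite.emptyI)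
    have "infinite ({y \<in> S. g y = g z} - {a})"
      using z by simp
    then obtain b where b: "b \<in> {y \<in> S. g y = g z} - {a}"
      by (metis all_not_in_conv finite.emptyI)
    show thesis
      using a b that[of a b] that[of b a] by (cases "f a \<le> f b") auto
  qed
qed

text \<open>
  With unique successors, a walk is determined by its first vertex and its length.  The hypothesis
  \<open>take 1 w = take 1 w'\<close> says that the walks have the same first vertex, or are both empty.
\<close>

lemma deterministic_walks_prefix:
  assumes "single_valued A" "set (vwalk_arcs w) \<subseteq> A" "set (vwalk_arcs w') \<subseteq> A"
    and "take 1 w = take 1 w'" "length w \<le> length w'"
  shows "prefix w w'"
  using assms
proof (induct w arbitrary: w' rule: vwalk_arcs.induct)
  case (2 x)
  then show ?case by (cases w') auto
next
  case (3 x y w)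
  obtain y' v where w': "w' = x # y' # v"
    using 3(5,6) by (cases w' rule: vwalk_arcs.cases) auto
  have "(x, y) \<in> A" "(x, y') \<in> A"
    using 3(3,4) w' by auto
  then have "y = y'"
    using \<open>single_valued A\<close> by (auto dest: single_valuedD)
  then have "prefix (y # w) (y # v)"
    using 3(3-6) w' by (intro 3(1) \<open>single_valued A\<close>) auto
  with \<open>y = y'\<close> w' show ?case by simp
qed simp

text \<open>
  From the seam between \<open>q\<close> and \<open>r\<close>, the walk can be reconstructed backwards along \<open>q\<close> and forwards
  along \<open>r\<close>.
\<close>

definition two_sided_deterministic :: "'a vwalk \<Rightarrow> bool" where
  "two_sided_deterministic p \<longleftrightarrow> (\<exists>q r. p = q @ r \<and>
     single_valued ((set (vwalk_arcs q))\<inverse>) \<and> single_valued (set (vwalk_arcs r)))"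

text \<open>
  The arcs of the two halves and the vertices at the seam take finitely many values, so infinitely
  many members of an infinite set agree on them.  Among these, a member whose halves are both no
  longer than those of another one is a subpath of it, and two such members exist by Dickson's
  lemma.
\<close>

lemma well_quasi_ordered_on_two_sided_deterministic:
  assumes "finite V" "\<And>p. p \<in> P \<Longrightarrow> set p \<subseteq> V \<and> two_sided_deterministic p"
  shows "well_quasi_ordered_on P sublist"
proof -
  have "\<exists>q r. p = q @ r \<and> single_valued (set (vwalk_arcs (rev q))) \<and>
      single_valued (set (vwalk_arcs r))" if "p \<in> P" for p
    using assms(2)[OF that] by (auto simp: two_sided_deterministic_def set_vwalk_arcs_rev_converse)
  then obtain Q R where QR: "\<And>p. p \<in> P \<Longrightarrow> p = Q p @ R p \<and>
      single_valued (set (vwalk_arcs (rev (Q p)))) \<and> single_valued (set (vwalk_arcs (R p)))"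
    by metis
  define key where "key p = (set (vwalk_arcs (rev (Q p))), take 1 (rev (Q p)),
      set (vwalk_arcs (R p)), take 1 (R p))" for p
  have no_antichain: "\<exists>x \<in> S. \<exists>y \<in> S. x \<noteq> y \<and> sublist x y" if S: "S \<subseteq> P" "infinite S" for S
  proof -
    define L where "L = {w. set w \<subseteq> V \<and> length w \<le> 1}"
    have "key ` S \<subseteq> Pow (V \<times> V) \<times> L \<times> Pow (V \<times> V) \<times> L"
    proof
      fix k assume "k \<in> key ` S"
      then obtain p where p: "p \<in> P" "k = key p"
        using S by auto
      have "set p = set (Q p) \<union> set (R p)"
        using QR[OF p(1)] by (metis set_append)
      then have "set (rev (Q p)) \<subseteq> V" "set (R p) \<subseteq> V"
        using assms(2)[OF p(1)] by auto
      moreover from this have "set (take 1 (rev (Q p))) \<subseteq> V" "set (take 1 (R p)) \<subseteq> V"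
        by (meson set_take_subset subset_trans)+
      ultimately show "k \<in> Pow (V \<times> V) \<times> L \<times> Pow (V \<times> V) \<times> L"
        unfolding p key_def L_def by (auto dest!: arcs_in_vwalk_arcs)
    qed
    moreover have "finite (Pow (V \<times> V) \<times> L \<times> Pow (V \<times> V) \<times> L)"
      using assms(1) finite_lists_length_le[OF assms(1), of 1] by (simp add: L_def)
    ultimately have "finite (key ` S)"
      by (rule finite_subset)
    then obtain p0 where "infinite {p \<in> S. key p = key p0}"
      using pigeonhole_infinite[OF S(2)] by blast
    then obtain x y where xy: "x \<in> S" "y \<in> S" "key x = key y" "x \<noteq> y"
      "length (Q x) \<le> length (Q y)" "length (R x) \<le> length (R y)"
      by (rule infinite_comparable_pair_nat2[where f = "\<lambda>p. length (Q p)" and g = "\<lambda>p. length (R p)"])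
        auto
    have "prefix (rev (Q x)) (rev (Q y))"
      using xy QR S by (intro deterministic_walks_prefix[of "set (vwalk_arcs (rev (Q x)))"])
        (auto simp: key_def)
    then obtain a where a: "Q y = a @ Q x"
      by (metis suffix_to_prefix suffixE)
    have "prefix (R x) (R y)"
      using xy QR S by (intro deterministic_walks_prefix[of "set (vwalk_arcs (R x))"])
        (auto simp: key_def)
    then obtain b where b: "R y = R x @ b"
      by (auto simp: prefix_def)
    have "y = a @ x @ b"
      using QR[of x] QR[of y] xy S a b by (metis append_assoc subsetD)
    then have "sublist x y" by simp
    with xy show ?thesis by blast
  qed
  have "\<not> (\<exists>f :: nat \<Rightarrow> 'a list. \<forall>i. f i \<in> P \<and> sublist (f (Suc i)) (f i) \<and> f (Suc i) \<noteq> f i)"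
  proof
    assume "\<exists>f :: nat \<Rightarrow> 'a list. \<forall>i. f i \<in> P \<and> sublist (f (Suc i)) (f i) \<and> f (Suc i) \<noteq> f i"
    then obtain f :: "nat \<Rightarrow> 'a list" where f: "\<And>i. sublist (f (Suc i)) (f i)" "\<And>i. f (Suc i) \<noteq> f i"
      by blast
    have "length (f (Suc i)) < length (f i)" for i
      using f(1)[of i] f(2)[of i] by (auto simp: sublist_def)
    then have "(f (Suc i), f i) \<in> measure length" for i
      by simp
    then show False
      using wf_iff_no_infinite_down_chain[of "measure length"] by blast
  qed
  with no_antichain show ?thesis
    unfolding well_quasi_ordered_on_def by blast
qed

text \<open>
  The seam is where the path leaves the initial cycle \<open>c1\<close>.  Only arcs of \<open>c1\<close> lead into \<open>c1\<close>, so
  the path does not return to it, and the remaining arcs are those of the connecting path and the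
  terminal cycle.  Their union is single-valued because the connecting path starts no arc at its
  last vertex, the only vertex it shares with the terminal cycle.
\<close>

lemma bicycle_path_two_sided_deterministic:
  assumes "bicycle H" "p \<in> paths H"
  shows "two_sided_deterministic p"
proof -
  obtain c1 t c2 where
    c1: "c1 = [] \<or> simple_cycle H c1 \<and> set t \<inter> set c1 = {hd t}" and
    c2: "c2 = [] \<or> simple_cycle H c2 \<and> set t \<inter> set c2 = {last t}" and
    disj: "set c1 \<inter> set c2 = {}" and
    path: "vpath t (with_proj H)" and
    H: "parcs H = set (vwalk_arcs c1) \<union> set (vwalk_arcs t) \<union> set (vwalk_arcs c2)"
    using assms(1) unfolding bicycle_def by (elim exE conjE) (rule that; assumption)
  then have t: "distinct t" "t \<noteq> []"
    by (auto simp: vpath_def)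
  have c1_sv: "single_valued ((set (vwalk_arcs c1))\<inverse>)"
    using c1 simple_cycle_single_valued(2)[of H c1] by auto
  have c2_sv: "single_valued (set (vwalk_arcs c2))"
    using c2 simple_cycle_single_valued(1)[of H c2] by auto
  have t_sv: "single_valued (set (vwalk_arcs t))"
    using t by (intro single_valued_vwalk_arcs) (simp add: distinct_butlast)
  have t_tl: "hd t \<notin> set (tl t)" and t_bl: "last t \<notin> set (butlast t)"
    using t(2,1) by (cases t; simp) (metis append_butlast_last_id distinct_append disjoint_insert(1) list.set(2) t)
  have t_arc: "y \<notin> set c1" "x \<notin> set c2" if "(x, y) \<in> set (vwalk_arcs t)" for x y
  proof -
    have "y \<in> set (tl t)" "x \<in> set (butlast t)"
      using that Range_vwalk_arcs[of t] Domain_vwalk_arcs[of t] by auto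
    moreover from this have "y \<in> set t" "x \<in> set t"
      using t(2) by (auto dest: list.set_sel(2) in_set_butlastD)
    ultimately show "y \<notin> set c1" "x \<notin> set c2"
      using c1 c2 t_tl t_bl by (metis Int_iff empty_iff empty_set singletonD)+
  qed
  have into_c1: "(x, y) \<in> set (vwalk_arcs c1)" if "(x, y) \<in> parcs H" "y \<in> set c1" for x y
    using that H t_arc disj by (auto dest!: arcs_in_vwalk_arcs[of _ c2])

  define q r where "q = takeWhile (\<lambda>x. x \<in> set c1) p" and "r = dropWhile (\<lambda>x. x \<in> set c1) p"
  have p: "p = q @ r"
    by (simp add: q_def r_def)
  have pa: "set (vwalk_arcs p) \<subseteq> parcs H"
    using assms(2) by (simp add: mem_paths_iff)
  have qa: "set (vwalk_arcs q) \<subseteq> parcs H" and ra: "set (vwalk_arcs r) \<subseteq> parcs H"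
    using pa set_vwalk_arcs_append1[of q r] set_vwalk_arcs_append2[of r q] by (auto simp: p)
  have "set q \<subseteq> set c1"
    by (auto simp: q_def dest: set_takeWhileD)
  then have "set (vwalk_arcs q) \<subseteq> set (vwalk_arcs c1)"
    using qa into_c1 by (fastforce dest: arcs_in_vwalk_arcs[of _ q])
  then have "single_valued ((set (vwalk_arcs q))\<inverse>)"
    using c1_sv by (meson converse_mono single_valued_subset)
  moreover have "set r \<subseteq> - set c1"
  proof (rule set_confined_forward)
    show "r = [] \<or> hd r \<in> - set c1"
      using hd_dropWhile[of "\<lambda>x. x \<in> set c1" p] by (auto simp: r_def)
    fix x y assume "x \<in> - set c1" "(x, y) \<in> set (vwalk_arcs r)"
    then show "y \<in> - set c1"
      using into_c1[of x y] ra by (auto dest!: arcs_in_vwalk_arcs[of _ c1])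
  qed
  then have "a \<notin> set (vwalk_arcs c1)" if "a \<in> set (vwalk_arcs r)" for a
    using arcs_in_vwalk_arcs[of a r] arcs_in_vwalk_arcs[of a c1] that by auto
  then have "set (vwalk_arcs r) \<subseteq> set (vwalk_arcs t) \<union> set (vwalk_arcs c2)"
    using ra unfolding H by blast
  moreover have "single_valued (set (vwalk_arcs t) \<union> set (vwalk_arcs c2))"
    using t_sv c2_sv t_arc(2) by (auto simp: single_valued_def dest!: arcs_in_vwalk_arcs[of _ c2])
  ultimately show ?thesis
    unfolding two_sided_deterministic_def using p by (metis single_valued_subset)
qed


section \<open>An in-out cycle yields an infinite antichain\<close>

text \<open>
  Take a simple cycle with the same base vertex.  If it were not an in-out cycle, it would be a
  source or a sink cycle; the given cycle both starts and ends at a vertex of it, hence would be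
  trapped in it, and the vertices of large in-degree and of large out-degree would lie on it.
\<close>

lemma in_out_cycle_simple:
  assumes fin: "finite (parcs G)" and c: "in_out_cycle G c"
  obtains c' where "in_out_cycle G c'" "simple_cycle G c'"
proof -
  have cyc: "is_cycle G c"
    using c by (simp add: in_out_cycle_def)
  obtain c' where c': "simple_cycle G c'" "hd c' = hd c" "set c' \<subseteq> set c"
    by (rule cycle_contains_simple_cycle[OF cyc])
  have arcs: "set (vwalk_arcs c) \<subseteq> parcs G"
    using cyc by (simp add: is_cycle_def mem_paths_iff)
  have "hd c \<in> set c'"
    using c' by (metis hd_in_set is_cycle_def mem_paths_iff simple_cycle_def)
  moreover have "hd c = last c"
    using cyc by (simp add: is_cycle_def)
  ultimately have whole: "set c \<subseteq> set c'" if "source_cycle G c' \<or> sink_cycle G c'"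
    using that source_cycle_traps_walk(1)[OF fin _ arcs] sink_cycle_traps_walk(1)[OF fin _ arcs]
    by metis
  have "in_out_cycle G c'"
  proof (rule ccontr)
    assume not: "\<not> in_out_cycle G c'"
    then have "source_cycle G c' \<or> sink_cycle G c'"
      using c'(1) unfolding in_out_cycle_def source_cycle_def sink_cycle_def simple_cycle_def
      by (meson not_less)
    then have "set c \<subseteq> set c'" by (rule whole)
    then show False
      using not c c'(1) unfolding in_out_cycle_def simple_cycle_def by blast
  qed
  then show thesis using c'(1) by (rule that)
qed

text \<open>
  The base vertex is removed at one end, so that consecutive copies are joined by the closing arc
  of the cycle.
\<close>

lemma vwalk_arcs_cycle_power:
  assumes "is_cycle G c"
  shows "set (vwalk_arcs (concat (replicate k (butlast c)))) \<subseteq> set (vwalk_arcs c)"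
proof (induct k)
  case (Suc k)
  have c: "c \<noteq> []" "butlast c \<noteq> []" "c = butlast c @ [last c]"
    using assms by (cases c; cases "tl c"; simp add: is_cycle_def)+
  have arcs: "set (vwalk_arcs c) = insert (last (butlast c), last c) (set (vwalk_arcs (butlast c)))"
    using set_vwalk_arcs_snoc[OF c(2), of "last c"] c(3) by simp
  have hd: "hd (concat (replicate k (butlast c))) = last c" if "k > 0"
  proof -
    have "hd (butlast c) = hd c"
      using c(2,3) by (metis hd_append2)
    with that c(2) assms show ?thesis
      by (cases k) (auto simp: is_cycle_def)
  qed
  show ?case
  proof (cases k)
    case 0
    then show ?thesis using arcs by auto
  next
    case (Suc j)
    then have "concat (replicate k (butlast c)) \<noteq> []"
      using c by simp
    then show ?thesis
      using Suc.hyps hd Suc c(2) arcs by (auto simp: vwalk_arcs_append)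
  qed
qed simp

text \<open>
  Each of the two lists has its only arcs outside \<open>A\<close> at its two ends.  An occurrence of the first
  list that does not start (end) together with the second one would place its first (last) arc
  inside \<open>w'\<close>, all of whose arcs are in \<open>A\<close>.  This also covers the case in which the two outside
  arcs coincide.
\<close>

lemma detour_sublist_imp_eq:
  assumes w: "w \<noteq> []" "set (vwalk_arcs w) \<subseteq> A"
    and w': "w' \<noteq> []" "set (vwalk_arcs w') \<subseteq> A"
    and out: "(x, hd w) \<notin> A" "(last w, y) \<notin> A"
    and sub: "sublist (x # w @ [y]) (x # w' @ [y])"
  shows "w = w'"
proof -
  obtain ps ss where eq: "x # w' @ [y] = ps @ (x # w @ [y]) @ ss"
    using sub by (auto simp: sublist_def)
  have "ps = []"
  proof (rule ccontr)
    assume "ps \<noteq> []"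
    then obtain ps' where "ps = x # ps'"
      using eq by (cases ps) auto
    then have "w' = butlast (ps' @ (x # w @ [y]) @ ss)"
      using eq by (metis append_Cons butlast_snoc list.inject)
    also have "\<dots> = ps' @ x # w @ butlast (y # ss)"
      by (simp add: butlast_append)
    finally have "(x, hd w) \<in> set (vwalk_arcs w')"
      using w(1) by (simp add: set_vwalk_arcs_append_Cons[of ps' x "w @ butlast (y # ss)"] del: butlast.simps)
    with w' out show False by auto
  qed
  moreover have "ss = []"
  proof (rule ccontr)
    assume ss: "ss \<noteq> []"
    have "w' = butlast (w @ y # ss)"
      using eq \<open>ps = []\<close> by (metis append.assoc append_Cons append_Nil butlast_snoc list.inject)
    also have "\<dots> = w @ y # butlast ss"
      using ss by (simp add: butlast_append)
    finally have "(last w, y) \<in> set (vwalk_arcs w')"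
      using w(1) by (auto simp: vwalk_arcs_append)
    with w' out show False by auto
  qed
  ultimately show ?thesis using eq by simp
qed

lemma in_out_cycle_imp_not_wqo:
  assumes G: "pair_fin_digraph G" and "in_out_cycle G c0"
  shows "\<not> well_quasi_ordered_on (paths G) sublist"
proof -
  interpret pair_fin_digraph G by fact
  note fin = pair_finite_arcs
  obtain c where c: "in_out_cycle G c" "simple_cycle G c"
    using in_out_cycle_simple[OF fin assms(2)] .
  define A where "A = set (vwalk_arcs c)"
  have cyc: "is_cycle G c" and A_G: "A \<subseteq> parcs G"
    using c(2) by (auto simp: simple_cycle_def is_cycle_def mem_paths_iff A_def)
  obtain u v where u: "u \<in> set c" "in_degree (with_proj G) u > 1"
    and v: "v \<in> set c" "out_degree (with_proj G) v > 1"
    using c(1) by (auto simp: in_out_cycle_def)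
  \<comment> \<open>Only one of two arcs into \<open>u\<close> (out of \<open>v\<close>) can lie on the simple cycle.\<close>
  obtain x where x: "(x, u) \<in> parcs G" "(x, u) \<notin> A"
    using u(2) simple_cycle_single_valued(2)[OF c(2)]
    unfolding in_degree_gt_1_iff[OF fin] A_def by (metis converseI single_valuedD)
  obtain y where y: "(v, y) \<in> parcs G" "(v, y) \<notin> A"
    using v(2) simple_cycle_single_valued(1)[OF c(2)]
    unfolding out_degree_gt_1_iff[OF fin] A_def by (metis single_valuedD)
  obtain a b where ab: "butlast c = a @ u # b"
    using u(1) cycle_set(1)[OF cyc] by (metis in_set_conv_decomp)
  obtain a' b' where ab': "butlast c = a' @ v # b'"
    using v(1) cycle_set(1)[OF cyc] by (metis in_set_conv_decomp)
  \<comment> \<open>From \<open>u\<close> to the end of the cycle, \<open>k\<close> times around, and on to \<open>v\<close>.\<close>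
  define w where "w k = (u # b) @ concat (replicate k (butlast c)) @ (a' @ [v])" for k
  define f where "f k = x # w k @ [y]" for k
  have w_ends: "w k \<noteq> []" "hd (w k) = u" "last (w k) = v" for k
    by (auto simp: w_def)
  have w_A: "set (vwalk_arcs (w k)) \<subseteq> A" for k
  proof -
    have "concat (replicate (Suc (Suc k)) (butlast c)) =
        butlast c @ concat (replicate k (butlast c)) @ butlast c"
      by (metis append_assoc concat.simps(2) concat_append concat.simps(1) append_Nil2
          replicate_Suc replicate_append_same)
    also have "\<dots> = a @ w k @ b'"
      by (subst ab, subst (2) ab') (simp add: w_def)
    finally have "sublist (w k) (concat (replicate (Suc (Suc k)) (butlast c)))"
      by simp
    then show ?thesis
      using set_vwalk_arcs_sublist vwalk_arcs_cycle_power[OF cyc] unfolding A_def by blast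
  qed
  have f_paths: "f k \<in> paths G" for k
  proof -
    have "set (vwalk_arcs (f k)) = insert (x, u) (insert (v, y) (set (vwalk_arcs (w k))))"
      using w_ends[of k] by (auto simp: f_def set_vwalk_arcs_snoc)
    then have "set (vwalk_arcs (f k)) \<subseteq> parcs G"
      using x y w_A[of k] A_G by auto
    moreover have "set (w k) \<subseteq> pverts G"
    proof -
      have "set c \<subseteq> pverts G"
        using cyc by (simp add: is_cycle_def mem_paths_iff)
      then have "set (butlast c) \<subseteq> pverts G"
        by (auto dest: in_set_butlastD)
      moreover from this have "set (a @ u # b) \<subseteq> pverts G" "set (a' @ v # b') \<subseteq> pverts G"
        unfolding ab[symmetric] ab'[symmetric] by auto
      ultimately show ?thesis by (auto simp: w_def)
    qed
    ultimately show ?thesis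
      using x y by (auto simp: mem_paths_iff f_def dest: wellformed')
  qed
  have "strict_mono (\<lambda>k. length (f k))"
    unfolding strict_mono_Suc_iff by (auto simp: f_def w_def ab)
  then have "inj f"
    by (metis (no_types, lifting) injI strict_mono_eq)
  then have "infinite (range f)"
    by (rule range_inj_infinite)
  moreover have "\<not> sublist p p'" if in_f: "p \<in> range f" "p' \<in> range f" "p \<noteq> p'" for p p'
  proof
    assume sub: "sublist p p'"
    obtain k k' where k: "p = f k" "p' = f k'"
      using in_f by blast
    have "w k = w k'"
      using detour_sublist_imp_eq[of "w k" A "w k'" x y] w_ends w_A x y sub k by (simp add: f_def)
    with in_f k show False by (simp add: f_def)
  qed
  ultimately have "\<exists>S \<subseteq> paths G. infinite S \<and> (\<forall>p \<in> S. \<forall>p' \<in> S. p \<noteq> p' \<longrightarrow> \<not> sublist p p')"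
    using f_paths by (intro exI[of _ "range f"]) blast
  then show ?thesis
    unfolding well_quasi_ordered_on_def by simp
qed


section \<open>The equivalence\<close>

theorem theorem3p1:
  fixes G :: "'a pair_pre_digraph"
  assumes "pair_fin_digraph G"
  shows "((\<nexists>c. in_out_cycle G c) \<longleftrightarrow>
            (\<exists>Hs. path_complete_decomposition G Hs \<and> (\<forall>H \<in> Hs. bicycle H))) \<and>
         ((\<exists>Hs. path_complete_decomposition G Hs \<and> (\<forall>H \<in> Hs. bicycle H)) \<longleftrightarrow>
            well_quasi_ordered_on (paths G) sublist)"
proof -
  have "well_quasi_ordered_on (paths G) sublist"
    if Hs: "path_complete_decomposition G Hs" "\<forall>H \<in> Hs. bicycle H" for Hs
  proof (rule well_quasi_ordered_on_two_sided_deterministic)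
    show "finite (pverts G)"
      using assms by (rule pair_fin_digraph.pair_finite_verts)
    fix p assume p: "p \<in> paths G"
    then obtain H where "H \<in> Hs" "p \<in> paths H"
      using Hs(1) by (auto simp: path_complete_decomposition_def)
    then show "set p \<subseteq> pverts G \<and> two_sided_deterministic p"
      using p Hs(2) bicycle_path_two_sided_deterministic by (auto simp: mem_paths_iff[of p G])
  qed
  then show ?thesis
    using bicycle_decomposition[OF assms] in_out_cycle_imp_not_wqo[OF assms] by blast
qed

end
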